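(* Let $G=(V,E)$ and $G'=(V',E')$ be graphs, let $\mathcal{S}$ be a set of distributions on $G$, and let $D$ be an $\mathcal{S}$-solvable distribution on $G$. Let $\{D'_r\}_{r\ge 0}$ be a family of distributions on $G'$ such that $D'_r$ is $r$-solvable for each $r\ge1$ ($D'_0$ arbitrary). Define the distribution $\Delta$ on $G\Box G'$ by $\Delta((v,w))=D'_{D(v)}(w)$. Then $\Delta$ is $(\mathcal{S}\cdot\mathcal{S}_1(G'))$-solvable in $G\Box G'$; that is, for every $\overline{D}\in\mathcal{S}$ and every $w\in V'$, the distribution on $G\Box G'$ placing $\overline{D}(v)$ pebbles on $(v,w)$ for each $v\in V$ (and none elsewhere) is reachable from $\Delta$.
   Context: Graphs are finite simple graphs. A distribution on a graph $G=(V,E)$ is a function $D:V\to\mathbb{N}$. $D$ contains $D'$ if $D'(v)\le D(v)$ for all $v$. A pebbling move removes two pebbles from a vertex having at least two pebbles and places one pebble on a neighbor. $D_2$ is reachable from $D_1$ if some sequence of pebbling moves starting from $D_1$ results in a distribution containing $D_2$. For a set $\mathcal{S}$ of distributions, $D$ is $\mathcal{S}$-solvable if every distribution in $\mathcal{S}$ is reachable from $D$. $D$ is $r$-solvable if, for every vertex $v$, the distribution with $r$ pebbles on $v$ and none elsewhere is reachable from $D$. $\mathcal{S}_1(G')$ is the set of distributions on $G'$ with one pebble on a single vertex and none elsewhere. $G\Box G'$ is the Cartesian product; for distributions $D$ on $G$, $D'$ on $G'$, $(D\cdot D')((x,x'))=D(x)D'(x')$, and $\mathcal{S}\cdot\mathcal{S}'=\{D\cdot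 D': D\in\mathcal{S},D'\in\mathcal{S}'\}$. *)

theory Defs
  imports "Graph_Theory.Pair_Digraph"
begin

text \<open>
  Finite simple graphs are the instances of \<^locale>\<open>pair_graph\<close>: finite, loopfree digraphs whose
  arc relation is symmetric, each undirected edge being represented by its two orientations.
\<close>

type_synonym 'a distribution = "'a \<Rightarrow> nat"

text \<open>
  Functions from the vertex set to the naturals are represented by total functions that vanish
  outside the vertex set.  "\<open>D\<close> contains \<open>D'\<close>" is then the pointwise order \<open>D' \<le> D\<close>.
\<close>

definition distributions :: "'a pair_pre_digraph \<Rightarrow> 'a distribution set" where
  "distributions G = {D. \<forall>v. v \<notin> pverts G \<longrightarrow> D v = 0}"

definition pebbling_move :: "'a pair_pre_digraph \<Rightarrow> 'a distribution \<Rightarrow> 'a distribution \<Rightarrow> bool" where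
  "pebbling_move G D D' \<longleftrightarrow>
     (\<exists>u v. (u, v) \<in> parcs G \<and> 2 \<le> D u \<and> D' = D(u := D u - 2, v := D v + 1))"

definition pebbling_reachable ::
  "'a pair_pre_digraph \<Rightarrow> 'a distribution \<Rightarrow> 'a distribution \<Rightarrow> bool" where
  "pebbling_reachable G D1 D2 \<longleftrightarrow> (\<exists>D. (pebbling_move G)\<^sup>*\<^sup>* D1 D \<and> D2 \<le> D)"

definition set_solvable ::
  "'a pair_pre_digraph \<Rightarrow> 'a distribution set \<Rightarrow> 'a distribution \<Rightarrow> bool" where
  "set_solvable G S D \<longleftrightarrow> (\<forall>D'\<in>S. pebbling_reachable G D D')"

definition pebbles_at :: "nat \<Rightarrow> 'a \<Rightarrow> 'a distribution" where
  "pebbles_at r v = (\<lambda>x. if x = v then r else 0)"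

definition r_solvable :: "'a pair_pre_digraph \<Rightarrow> nat \<Rightarrow> 'a distribution \<Rightarrow> bool" where
  "r_solvable G r D \<longleftrightarrow> (\<forall>v\<in>pverts G. pebbling_reachable G D (pebbles_at r v))"

definition single_pebble_dists :: "'a pair_pre_digraph \<Rightarrow> 'a distribution set" where
  "single_pebble_dists G = pebbles_at 1 ` pverts G"

definition cart_prod ::
  "'a pair_pre_digraph \<Rightarrow> 'b pair_pre_digraph \<Rightarrow> ('a \<times> 'b) pair_pre_digraph" where
  "cart_prod G G' =
     \<lparr> pverts = pverts G \<times> pverts G',
       parcs = {((x, x'), (y, y')) | x x' y y'.
                  (x = y \<and> x \<in> pverts G \<and> (x', y') \<in> parcs G') \<or>
                  (x' = y' \<and> x' \<in> pverts G' \<and> (x, y) \<in> parcs G)} \<rparr>"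

definition dist_prod :: "'a distribution \<Rightarrow> 'b distribution \<Rightarrow> ('a \<times> 'b) distribution" where
  "dist_prod D D' = (\<lambda>(x, x'). D x * D' x')"

definition dist_set_prod ::
  "'a distribution set \<Rightarrow> 'b distribution set \<Rightarrow> ('a \<times> 'b) distribution set" where
  "dist_set_prod S S' = {dist_prod D D' | D D'. D \<in> S \<and> D' \<in> S'}"

text \<open>
  The distribution \<open>(v, w) \<mapsto> D' (D v) w\<close> on the product.  The guard is needed because \<open>D' 0\<close> need
  not be the zero distribution, so the formula alone need not vanish for \<open>v\<close> outside \<open>G\<close>.
\<close>

definition layered_dist ::
  "'a pair_pre_digraph \<Rightarrow> 'a distribution \<Rightarrow> (nat \<Rightarrow> 'b distribution) \<Rightarrow> ('a \<times> 'b) distribution" where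
  "layered_dist G D D' = (\<lambda>(v, w). if v \<in> pverts G then D' (D v) w else 0)"

lemma pair_graph_cart_prod:
  assumes "pair_graph G" and "pair_graph G'"
  shows "pair_graph (cart_prod G G')"
proof -
  interpret G: pair_graph G by fact
  interpret G': pair_graph G' by fact
  have sub: "parcs (cart_prod G G') \<subseteq> (pverts G \<times> pverts G') \<times> (pverts G \<times> pverts G')"
    by (auto simp: cart_prod_def dest: G.wellformed' G'.wellformed')
  have sG: "sym (parcs G)" using G.pair_sym_arcs by (simp add: symmetric_def)
  have sG': "sym (parcs G')" using G'.pair_sym_arcs by (simp add: symmetric_def)
  show ?thesis
  proof
    show "finite (parcs (cart_prod G G'))"
      by (rule finite_subset[OF sub]) (simp add: G.pair_finite_verts G'.pair_finite_verts)
    show "symmetric (cart_prod G G')"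
      using sG sG' by (auto simp: symmetric_def cart_prod_def sym_def)
  qed (use sub G.pair_no_loops G'.pair_no_loops in
        \<open>auto simp: cart_prod_def G.pair_finite_verts G'.pair_finite_verts
              dest: G.wellformed' G'.wellformed'\<close>)
qed

lemma layered_dist_in_distributions:
  assumes "\<And>r. D' r \<in> distributions G'"
  shows "layered_dist G D D' \<in> distributions (cart_prod G G')"
  using assms by (auto simp: layered_dist_def distributions_def cart_prod_def)

end

theory Submission
  imports Defs
begin

text \<open>
  First work in the fibres over the vertices \<open>v\<close> of \<open>G\<close>, one after the other: the fibre over \<open>v\<close> is
  a copy of \<open>G'\<close> carrying \<open>D' (D v)\<close>, so \<open>D v\<close> pebbles can be moved to \<open>(v, w)\<close>. The layer
  \<open>pverts G \<times> {w}\<close> is then a copy of \<open>G\<close> containing \<open>D\<close>, which solves every distribution in \<open>S\<close>.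
\<close>

text \<open>Extra pebbles never block a move: the same arc \<open>(u, v)\<close> is used from
  \<open>E1\<close>, and truncated subtraction is monotone.\<close>

lemma pebbling_move_mono:
  assumes "pebbling_move G D1 D2" "D1 \<le> E1"
  shows "\<exists>E2. pebbling_move G E1 E2 \<and> D2 \<le> E2"
proof -
  obtain u v where uv: "(u, v) \<in> parcs G" "2 \<le> D1 u" "D2 = D1(u := D1 u - 2, v := D1 v + 1)"
    using assms(1) unfolding pebbling_move_def by blast
  have le: "D1 x \<le> E1 x" for x
    using assms(2) by (simp add: le_fun_def)
  let ?E2 = "E1(u := E1 u - 2, v := E1 v + 1)"
  have "pebbling_move G E1 ?E2"
    unfolding pebbling_move_def using uv(1) order_trans[OF uv(2) le] by blast
  moreover have "D2 \<le> ?E2"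
    using le by (auto simp: uv(3) le_fun_def intro: diff_le_mono)
  ultimately show ?thesis by blast
qed

lemma pebbling_moves_mono:
  assumes "(pebbling_move G)\<^sup>*\<^sup>* D1 D2" "D1 \<le> E1"
  shows "\<exists>E2. (pebbling_move G)\<^sup>*\<^sup>* E1 E2 \<and> D2 \<le> E2"
  using assms
proof (induction rule: rtranclp_induct)
  case (step D2 D3)
  then obtain E2 where E2: "(pebbling_move G)\<^sup>*\<^sup>* E1 E2" "D2 \<le> E2"
    by blast
  then obtain E3 where "pebbling_move G E2 E3" "D3 \<le> E3"
    using pebbling_move_mono[OF step.hyps(2)] by blast
  with E2(1) show ?case by (blast intro: rtranclp.rtrancl_into_rtrancl)
qed blast

lemma pebbling_reachable_mono:
  assumes "pebbling_reachable G D1 D2" "D1 \<le> E1"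
  shows "pebbling_reachable G E1 D2"
proof -
  obtain D3 where D3: "(pebbling_move G)\<^sup>*\<^sup>* D1 D3" "D2 \<le> D3"
    using assms(1) unfolding pebbling_reachable_def by blast
  obtain E3 where "(pebbling_move G)\<^sup>*\<^sup>* E1 E3" "D3 \<le> E3"
    using pebbling_moves_mono[OF D3(1) assms(2)] by blast
  with order_trans[OF D3(2)] show ?thesis unfolding pebbling_reachable_def by blast
qed

text \<open>The move along \<open>(u, v)\<close> in \<open>H\<close> is copied by the move along
  \<open>(f u, f v)\<close> in \<open>K\<close>. Injectivity keeps the pullback along
  \<open>f\<close> exact, since the updates at \<open>f u\<close> and \<open>f v\<close> are then
  seen only at \<open>u\<close> and \<open>v\<close>. The last clause records that nothing outside
  the copy of \<open>H\<close> changes, so that several disjoint copies can be treated in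
  turn.\<close>

lemma pebbling_move_lift:
  assumes "inj f" "\<forall>(x, y)\<in>parcs H. (f x, f y) \<in> parcs K"
    and "pebbling_move H (E \<circ> f) D2"
  shows "\<exists>E'. pebbling_move K E E' \<and> E' \<circ> f = D2 \<and> (\<forall>y. y \<notin> range f \<longrightarrow> E' y = E y)"
proof -
  obtain u v where uv: "(u, v) \<in> parcs H" "2 \<le> E (f u)"
      "D2 = (E \<circ> f)(u := E (f u) - 2, v := E (f v) + 1)"
    using assms(3) unfolding pebbling_move_def by auto
  let ?E' = "E(f u := E (f u) - 2, f v := E (f v) + 1)"
  have "pebbling_move K E ?E'"
    using uv assms(2) unfolding pebbling_move_def by blast
  moreover have "?E' \<circ> f = D2"
    by (auto simp: uv(3) fun_eq_iff inj_eq[OF assms(1)])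
  moreover have "\<forall>y. y \<notin> range f \<longrightarrow> ?E' y = E y"
    by auto
  ultimately show ?thesis by blast
qed

lemma pebbling_moves_lift:
  assumes "inj f" "\<forall>(x, y)\<in>parcs H. (f x, f y) \<in> parcs K"
    and "(pebbling_move H)\<^sup>*\<^sup>* (E \<circ> f) D2"
  shows "\<exists>E'. (pebbling_move K)\<^sup>*\<^sup>* E E' \<and> E' \<circ> f = D2 \<and> (\<forall>y. y \<notin> range f \<longrightarrow> E' y = E y)"
  using assms(3)
proof (induction rule: rtranclp_induct)
  case (step D2 D3)
  then obtain E1 where E1: "(pebbling_move K)\<^sup>*\<^sup>* E E1" "E1 \<circ> f = D2"
      "\<And>y. y \<notin> range f \<Longrightarrow> E1 y = E y"
    by blast
  \<comment> \<open>The invariant is an equality, so the next move in \<open>H\<close> starts from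
    the pullback of \<open>E1\<close> itself and can be lifted as it stands.\<close>
  have "pebbling_move H (E1 \<circ> f) D3"
    using step.hyps(2) E1(2) by simp
  then obtain E2 where E2: "pebbling_move K E1 E2" "E2 \<circ> f = D3"
      "\<forall>y. y \<notin> range f \<longrightarrow> E2 y = E1 y"
    using pebbling_move_lift[OF assms(1,2)] by blast
  have "(pebbling_move K)\<^sup>*\<^sup>* E E2"
    using E1(1) E2(1) by (blast intro: rtranclp.rtrancl_into_rtrancl)
  moreover have "\<forall>y. y \<notin> range f \<longrightarrow> E2 y = E y"
    using E1(3) E2(3) by simp
  ultimately show ?case
    using E2(2) by blast
qed blast

text \<open>Serves two embeddings into the product: \<open>Pair v\<close>, whose image is the fibre
  over \<open>v\<close>, and \<open>\<lambda>v. (v, w)\<close>, whose image is the layer at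
  \<open>w\<close>.\<close>

lemma pebbling_reachable_lift:
  assumes "inj f" "\<forall>(x, y)\<in>parcs H. (f x, f y) \<in> parcs K"
    and "pebbling_reachable H (E \<circ> f) D2"
  shows "\<exists>E'. (pebbling_move K)\<^sup>*\<^sup>* E E' \<and> (\<forall>x. D2 x \<le> E' (f x)) \<and>
    (\<forall>y. y \<notin> range f \<longrightarrow> E' y = E y)"
proof -
  obtain D3 where D3: "(pebbling_move H)\<^sup>*\<^sup>* (E \<circ> f) D3" "D2 \<le> D3"
    using assms(3) unfolding pebbling_reachable_def by blast
  obtain E' where "(pebbling_move K)\<^sup>*\<^sup>* E E'" "E' \<circ> f = D3" "\<forall>y. y \<notin> range f \<longrightarrow> E' y = E y"
    using pebbling_moves_lift[OF assms(1,2) D3(1)] by blast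
  with D3(2) show ?thesis by (intro exI[of _ E']) (auto simp: le_fun_def)
qed

text \<open>Fibres over distinct vertices are disjoint, so they can be processed one by one, by
  induction on the set \<open>A\<close> of vertices already treated. The last clause makes the
  induction work: the fibre over the next vertex still carries its initial pebbles.\<close>

lemma fibrewise_reachable:
  assumes "finite A" "A \<subseteq> pverts G"
    and "\<And>v. v \<in> A \<Longrightarrow> pebbling_reachable G' (\<lambda>x. E (v, x)) (pebbles_at (D v) w)"
  shows "\<exists>E'. (pebbling_move (cart_prod G G'))\<^sup>*\<^sup>* E E' \<and> (\<forall>v\<in>A. D v \<le> E' (v, w)) \<and>
    (\<forall>v x. v \<notin> A \<longrightarrow> E' (v, x) = E (v, x))"
  using assms
proof (induction rule: finite_induct)
  case (insert v A)
  then obtain E1 where E1: "(pebbling_move (cart_prod G G'))\<^sup>*\<^sup>* E E1"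
      "\<And>u. u \<in> A \<Longrightarrow> D u \<le> E1 (u, w)" "\<And>u x. u \<notin> A \<Longrightarrow> E1 (u, x) = E (u, x)"
    by auto
  have "E1 \<circ> Pair v = (\<lambda>x. E (v, x))"
    using E1(3) insert.hyps(2) by auto
  then have reach: "pebbling_reachable G' (E1 \<circ> Pair v) (pebbles_at (D v) w)"
    using insert.prems(2) by simp
  \<comment> \<open>The product has arcs inside the fibre over \<open>v\<close> only for a vertex
    \<open>v\<close> of \<open>G\<close>; this is where \<open>A \<subseteq> pverts G\<close>
    enters.\<close>
  have arcs: "\<forall>(x, y)\<in>parcs G'. (Pair v x, Pair v y) \<in> parcs (cart_prod G G')"
    using insert.prems(1) by (auto simp: cart_prod_def)
  have inj: "inj (Pair v)"
    by (simp add: inj_on_def)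
  obtain E2 where E2: "(pebbling_move (cart_prod G G'))\<^sup>*\<^sup>* E1 E2"
      "\<forall>x. pebbles_at (D v) w x \<le> E2 (v, x)" "\<forall>y. y \<notin> range (Pair v) \<longrightarrow> E2 y = E1 y"
    using pebbling_reachable_lift[OF inj arcs reach] by (elim exE conjE)
  have other: "E2 (u, x) = E1 (u, x)" if "u \<noteq> v" for u x
    using E2(3)[rule_format, of "(u, x)"] that by auto
  have "D v \<le> E2 (v, w)"
    using E2(2)[rule_format, of w] by (simp add: pebbles_at_def)
  then have "\<forall>u\<in>insert v A. D u \<le> E2 (u, w)"
    using E1(2) other insert.hyps(2) by (metis insert_iff)
  moreover have "\<forall>u x. u \<notin> insert v A \<longrightarrow> E2 (u, x) = E (u, x)"
    using E1(3) other by auto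
  moreover have "(pebbling_move (cart_prod G G'))\<^sup>*\<^sup>* E E2"
    using E1(1) E2(1) by (rule rtranclp_trans)
  ultimately show ?case by blast
qed auto

theorem theorem5p6:
  fixes G :: "'a pair_pre_digraph" and G' :: "'b pair_pre_digraph"
    and S :: "'a distribution set" and D :: "'a distribution"
    and D' :: "nat \<Rightarrow> 'b distribution"
  assumes "pair_graph G" and "pair_graph G'"
    and "S \<subseteq> distributions G"
    and "D \<in> distributions G" and "set_solvable G S D"
    and "\<And>r. D' r \<in> distributions G'"
    and "\<And>r. 1 \<le> r \<Longrightarrow> r_solvable G' r (D' r)"
  shows "set_solvable (cart_prod G G') (dist_set_prod S (single_pebble_dists G'))
           (layered_dist G D D')
       \<and> (\<forall>D''\<in>S. \<forall>w\<in>pverts G'.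
            pebbling_reachable (cart_prod G G') (layered_dist G D D')
              (\<lambda>(v, x). if x = w then D'' v else 0))"
proof -
  interpret G: pair_graph G by fact
  let ?K = "cart_prod G G'"
  have main: "pebbling_reachable ?K (layered_dist G D D') (\<lambda>(v, x). if x = w then D'' v else 0)"
    if D'': "D'' \<in> S" and w: "w \<in> pverts G'" for D'' w
  proof -
    have fibre: "pebbling_reachable G' (\<lambda>x. layered_dist G D D' (v, x)) (pebbles_at (D v) w)"
      if "v \<in> pverts G" for v
    proof (cases "D v = 0")
      \<comment> \<open>Nothing is known about how \<open>D' 0\<close> can be moved, but the target
        is now the zero distribution, which every distribution contains; no move is made.\<close>
      case True
      then show ?thesis by (auto simp: pebbling_reachable_def pebbles_at_def le_fun_def)
    next
      case False
      then have "r_solvable G' (D v) (D' (D v))"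
        by (intro assms(7)) simp
      with w that show ?thesis by (simp add: r_solvable_def layered_dist_def)
    qed
    obtain E where E: "(pebbling_move ?K)\<^sup>*\<^sup>* (layered_dist G D D') E"
        "\<And>v. v \<in> pverts G \<Longrightarrow> D v \<le> E (v, w)"
      using fibrewise_reachable[OF G.pair_finite_verts order_refl fibre] by blast
    \<comment> \<open>The bound on \<open>E\<close> is available only at vertices of
      \<open>G\<close>; elsewhere \<open>D\<close> vanishes.\<close>
    have le: "D \<le> E \<circ> (\<lambda>v. (v, w))"
      unfolding le_fun_def
    proof
      fix v
      show "D v \<le> (E \<circ> (\<lambda>v. (v, w))) v"
        using E(2)[of v] assms(4) by (cases "v \<in> pverts G") (auto simp: distributions_def)
    qed
    \<comment> \<open>\<open>D\<close> solves \<open>D''\<close>, and by monotonicity so does the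
      layer of \<open>E\<close> at \<open>w\<close>, which contains \<open>D\<close>.\<close>
    have reach: "pebbling_reachable G (E \<circ> (\<lambda>v. (v, w))) D''"
      using assms(5) D'' le by (auto simp: set_solvable_def intro: pebbling_reachable_mono)
    have arcs: "\<forall>(u, v)\<in>parcs G. ((u, w), (v, w)) \<in> parcs ?K"
      using w by (auto simp: cart_prod_def)
    have inj: "inj (\<lambda>v. (v, w))"
      by (simp add: inj_on_def)
    obtain E' where E': "(pebbling_move ?K)\<^sup>*\<^sup>* E E'" "\<forall>v. D'' v \<le> E' (v, w)"
      using pebbling_reachable_lift[OF inj arcs reach] by (elim exE conjE)
    have "(pebbling_move ?K)\<^sup>*\<^sup>* (layered_dist G D D') E'"
      using E(1) E'(1) by (rule rtranclp_trans)
    moreover have "(\<lambda>(v, x). if x = w then D'' v else 0) \<le> E'"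
      using E'(2) by (auto simp: le_fun_def)
    ultimately show ?thesis by (auto simp: pebbling_reachable_def)
  qed
  \<comment> \<open>A single pebble at \<open>w\<close> acts as an indicator function in the
    product, so both conjuncts of the theorem concern the same target distributions.\<close>
  have "dist_prod D'' (pebbles_at 1 w) = (\<lambda>(v, x). if x = w then D'' v else 0)"
    for D'' :: "'a distribution" and w :: 'b
    by (auto simp: dist_prod_def pebbles_at_def)
  with main show ?thesis
    by (auto simp: set_solvable_def dist_set_prod_def single_pebble_dists_def)
qed

end
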